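(* Let $X\subseteq \mathbb{R}$ be a bounded infinite set which contains, for arbitrarily small $\sigma>0$ (i.e. for every $\sigma_0>0$ there is some $\sigma\in(0,\sigma_0)$ for which there exists), a finite subset $\{x_1, x_2, \dots, x_n \}\subseteq X$ with $n\ge 3$, $x_1>x_2> \dots > x_n$, and $$\min_{i=1,\dots,n-1} \frac{x_i-x_{i+1}}{x_1-x_n} \geq (1-\sigma)^n$$ (here $n$ and the $x_i$ may depend on $\sigma$). Then $X$ is non-universal (modulo similarities) with respect to the sets with complement of finite Lebesgue measure. Moreover, for every $\varepsilon >0$ there exists an open set $G\subseteq \mathbb{R}$ with $\lambda (G)<\varepsilon$ such that any similar copy of $X$ intersects $G$ in an infinite set; in other words, the set $\mathbb{R} \setminus G$ does not contain any similar copy of $X \setminus K$, for any finite set $K$.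
   Context: $\lambda$ denotes (outer) Lebesgue measure on $\mathbb{R}$. A similar copy of a set $X\subseteq\mathbb{R}$ is a set of the form $a+bX=\{a+bx: x\in X\}$ with $a\in\mathbb{R}$ and $b\in\mathbb{R}\setminus\{0\}$. A set $X\subseteq\mathbb{R}$ is non-universal (modulo similarities) with respect to the sets with complement of finite Lebesgue measure if there is a Lebesgue measurable set $C\subseteq\mathbb{R}$ with $\lambda(\mathbb{R}\setminus C)<\infty$ that contains no similar copy of $X$. *)

theory Defs
  imports "HOL-Analysis.Lebesgue_Measure"
begin

definition similar_copy :: "real set \<Rightarrow> real set \<Rightarrow> bool" where
  "similar_copy Y X \<longleftrightarrow> (\<exists>a b. b \<noteq> 0 \<and> Y = (\<lambda>x. a + b * x) ` X)"

definition nonuniversal_cofinite_measure :: "real set \<Rightarrow> bool" where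
  "nonuniversal_cofinite_measure X \<longleftrightarrow>
     (\<exists>C \<in> sets lebesgue. emeasure lebesgue (UNIV - C) < \<infinity> \<and>
        (\<nexists>Y. similar_copy Y X \<and> Y \<subseteq> C))"

end

theory Submission
  imports Defs
begin

text \<open>
  Fix a finite subset of \<open>X\<close> with \<open>n\<close> points and gaps at least \<open>\<delta>\<close> times its diameter, rescaled to
  \<open>[0, 1]\<close>. On a grid of mesh \<open>1/q\<close> with \<open>q\<close> of order \<open>1/\<delta>\<close>, its copies \<open>a + b x\<close> with \<open>a \<in> [0, 1)\<close>
  and \<open>b \<in> [1/R, R]\<close> occupy only \<open>O(\<delta>\<^sup>-\<^sup>2)\<close> patterns, each consisting of \<open>n\<close> distinct cells. Greedily
  choosing the cell that meets most of the patterns not met so far, a proportion \<open>p\<close> of the cells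
  meets all but \<open>O(\<delta>\<^sup>-\<^sup>2) exp (- c p n)\<close> patterns. This is less than 1 if \<open>\<delta> \<ge> exp (- \<sigma> n)\<close> with
  \<open>\<sigma>\<close> small compared to \<open>p\<close> and \<open>n\<close> large, so all copies are met. Integer translates then take care of
  all \<open>a\<close> in a bounded range, at a total measure that is independent of the diameter.

  The hypothesis survives the removal of a finite set from \<open>X\<close>. Hence one can use pairwise disjoint
  finite sets for an increasing sequence of parameter ranges \<open>\<bar>a\<bar> \<le> N\<close>, \<open>1/N \<le> b \<le> N\<close>; every copy is
  met in a new point at each late stage, hence infinitely often.
\<close>

section \<open>Greedy hitting sets for finite set systems\<close>

text \<open>Counting incidences between the sets not yet met and the points of \<open>U\<close>
  shows that some point lies in at least a proportion \<open>n / card U\<close> of these sets.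
  Adding it multiplies their number by at most \<open>1 - n / card U\<close>, which is at most
  \<open>exp (- n / card U)\<close>; \<open>k\<close> such choices give the bound.\<close>

lemma greedy_hitting_set:
  fixes A :: "'i \<Rightarrow> 'a set"
  assumes U: "finite U" "U \<noteq> {}" and I: "finite I"
    and A: "\<And>i. i \<in> I \<Longrightarrow> A i \<subseteq> U" "\<And>i. i \<in> I \<Longrightarrow> n \<le> card (A i)"
  shows "\<exists>S\<subseteq>U. card S \<le> k \<and>
           real (card {i\<in>I. A i \<inter> S = {}}) \<le> real (card I) * exp (- (real n * real k / real (card U)))"
proof (induction k)
  case 0
  show ?case by (rule exI[of _ "{}"]) simp
next
  case (Suc k)
  then obtain S where S: "S \<subseteq> U" "card S \<le> k"
    and le: "real (card {i\<in>I. A i \<inter> S = {}}) \<le> real (card I) * exp (- (real n * real k / real (card U)))"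
    by blast
  define J where "J = {i\<in>I. A i \<inter> S = {}}"
  have J: "finite J" "J \<subseteq> I" using I by (auto simp: J_def)
  have M: "real (card U) > 0" using U by (simp add: card_gt_0_iff)
  have count: "(\<Sum>u\<in>U. card {i\<in>J. u \<in> A i}) = (\<Sum>i\<in>J. card (A i))"
  proof -
    have "(\<Sum>u\<in>U. card {i\<in>J. u \<in> A i}) = (\<Sum>u\<in>U. \<Sum>i\<in>J. if u \<in> A i then 1 else 0)"
      using J(1) by (intro sum.cong) (auto simp: sum.If_cases Collect_conj_eq)
    also have "\<dots> = (\<Sum>i\<in>J. \<Sum>u\<in>U. if u \<in> A i then 1 else 0)"
      by (rule sum.swap)
    also have "\<dots> = (\<Sum>i\<in>J. card (A i))"
      using U(1) A(1) J(2) by (intro sum.cong) (auto simp: sum.If_cases intro!: arg_cong[of _ _ card])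
    finally show ?thesis .
  qed
  \<comment> \<open>Otherwise every point has fewer incidences than the average, and summing over
    \<open>U\<close> contradicts \<open>count\<close>.\<close>
  have "\<exists>u\<in>U. real (card J) * real n \<le> real (card U) * real (card {i\<in>J. u \<in> A i})"
  proof (rule ccontr)
    assume "\<not> ?thesis"
    then have "(\<Sum>u\<in>U. real (card U) * real (card {i\<in>J. u \<in> A i})) < (\<Sum>u\<in>U. real (card J) * real n)"
      using U by (intro sum_strict_mono) auto
    then have "real (card U) * real (\<Sum>u\<in>U. card {i\<in>J. u \<in> A i}) < real (card U) * (real (card J) * real n)"
      by (simp add: sum_distrib_left)
    then have "real (\<Sum>i\<in>J. card (A i)) < real (card J * n)"
      using M count by simp
    moreover have "card J * n \<le> (\<Sum>i\<in>J. card (A i))"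
      using sum_bounded_below[of J n "\<lambda>i. card (A i)"] A(2) J by auto
    ultimately show False by linarith
  qed
  then obtain u where u: "u \<in> U"
    "real (card J) * real n \<le> real (card U) * real (card {i\<in>J. u \<in> A i})" by blast
  have split: "card J = card {i\<in>J. u \<in> A i} + card {i\<in>J. u \<notin> A i}"
  proof -
    have "J = {i\<in>J. u \<in> A i} \<union> {i\<in>J. u \<notin> A i}" by auto
    then show ?thesis using J(1) by (metis (no_types, lifting) card_Un_disjoint[of "{i\<in>J. u \<in> A i}" "{i\<in>J. u \<notin> A i}"]
       disjoint_iff finite_Un mem_Collect_eq)
  qed
  have "real (card {i\<in>J. u \<notin> A i}) \<le> real (card J) * (1 - real n / real (card U))"
    using u(2) M split by (simp add: field_simps)
  also have "\<dots> \<le> real (card J) * exp (- (real n / real (card U)))"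
    using exp_ge_add_one_self[of "- (real n / real (card U))"] by (intro mult_left_mono) auto
  also have "\<dots> \<le> real (card I) * exp (- (real n * real k / real (card U))) * exp (- (real n / real (card U)))"
    using le by (intro mult_right_mono) (auto simp: J_def)
  also have "\<dots> = real (card I) * exp (- (real n * real (Suc k) / real (card U)))"
    by (simp add: exp_add[symmetric] add_divide_distrib[symmetric] algebra_simps)
  finally have "real (card {i\<in>J. u \<notin> A i}) \<le> real (card I) * exp (- (real n * real (Suc k) / real (card U)))" .
  moreover have "{i\<in>I. A i \<inter> insert u S = {}} = {i\<in>J. u \<notin> A i}"
    by (auto simp: J_def)
  moreover have "card (insert u S) \<le> Suc k"
    using S finite_subset[OF S(1) U(1)] by (simp add: card_insert_if)
  ultimately show ?case
    using u(1) S(1) by (intro exI[of _ "insert u S"]) auto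
qed

section \<open>Normalised finite sets: translations in the unit interval\<close>

text \<open>The factors in \<open>small\<close> come from counting: there are at most
  \<open>q * (R * q + 1)\<close> patterns and exactly \<open>(R + 1) * q + 1\<close> cells. So the
  greedy choice of \<open>k\<close> cells leaves fewer than one pattern unmet, hence none. The
  length \<open>4 / q\<close> of each open interval absorbs all rounding errors.\<close>

lemma hitting_unit_translations_grid:
  fixes F :: "real set" and q R k :: nat
  assumes F: "finite F" "F \<subseteq> {0..1}"
    and sep: "\<And>x y. x \<in> F \<Longrightarrow> y \<in> F \<Longrightarrow> x \<noteq> y \<Longrightarrow> \<delta> \<le> \<bar>x - y\<bar>"
    and \<delta>: "0 < \<delta>" "\<delta> \<le> 1" and R: "1 \<le> R" and q: "2 * real R / \<delta> \<le> real q"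
    and small: "real (q * (R * q + 1)) * exp (- (real (card F) * real k / real ((R + 1) * q + 1))) < 1"
  shows "\<exists>G. open G \<and> emeasure lborel G \<le> ennreal (4 * real k / real q) \<and>
           (\<forall>a b. 0 \<le> a \<and> a < 1 \<and> 1 / real R \<le> b \<and> b \<le> real R \<longrightarrow> (\<exists>x\<in>F. a + b * x \<in> G))"
proof -
  have "2 \<le> 2 * real R / \<delta>" using \<delta> R by (simp add: field_simps)
  then have q0: "real q \<ge> 2" using q by linarith
  \<comment> \<open>The pair \<open>(i, j)\<close> stands for \<open>a = i/q\<close>, \<open>b = j/q\<close>, and \<open>c (i, j) x\<close> is the cell of \<open>a + b x\<close>.\<close>
  define U where "U = {0..(R + 1) * q}"
  define c where "c = (\<lambda>(i::nat, j::nat) x. i + nat \<lfloor>real j * x\<rfloor>)"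
  define I where "I = {..<q} \<times> {j. j \<le> R * q \<and> 1 \<le> real j * \<delta>}"
  have J_sub: "{j. j \<le> R * q \<and> 1 \<le> real j * \<delta>} \<subseteq> {..R * q}" by auto
  have finI: "finite I" unfolding I_def using finite_subset[OF J_sub] by auto
  have cardI: "card I \<le> q * (R * q + 1)"
    unfolding I_def card_cartesian_product using card_mono[OF _ J_sub] by (intro mult_le_mono) auto
  have inU: "c t ` F \<subseteq> U" if "t \<in> I" for t
  proof -
    obtain i j where t: "t = (i, j)" by (cases t)
    have ij: "i < q" "j \<le> R * q" using that t by (auto simp: I_def)
    have "nat \<lfloor>real j * x\<rfloor> \<le> R * q" if "x \<in> F" for x
    proof -
      have "0 \<le> x" "x \<le> 1" using that F(2) by auto
      then have "real j * x \<le> real j" by (simp add: mult_left_le)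
      then have "\<lfloor>real j * x\<rfloor> \<le> int j" by linarith
      then show ?thesis using ij by linarith
    qed
    then show ?thesis using ij by (auto simp: U_def c_def t algebra_simps intro!: add_mono)
  qed
  have cardc: "card F \<le> card (c t ` F)" if "t \<in> I" for t
  proof -
    obtain i j where t: "t = (i, j)" by (cases t)
    have j: "1 \<le> real j * \<delta>" using that t by (auto simp: I_def)
    \<comment> \<open>Points in the same cell satisfy \<open>j * \<bar>x - y\<bar> < 1\<close>,
      while separation gives at least \<open>j * \<delta>\<close>, which is at least 1 for pairs in
      \<open>I\<close>.\<close>
    have "inj_on (c t) F"
    proof (rule inj_onI, rule ccontr)
      fix x y assume xy: "x \<in> F" "y \<in> F" "c t x = c t y" "x \<noteq> y"
      have "0 \<le> x" "0 \<le> y" using xy F(2) by auto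
      then have nn: "0 \<le> real j * x" "0 \<le> real j * y" by auto
      have "nat \<lfloor>real j * x\<rfloor> = nat \<lfloor>real j * y\<rfloor>" using xy(3) by (simp add: c_def t)
      then have "\<lfloor>real j * x\<rfloor> = \<lfloor>real j * y\<rfloor>" using nn by (simp add: eq_nat_nat_iff)
      then have "\<bar>real j * x - real j * y\<bar> < 1" by linarith
      moreover have "real j * \<delta> \<le> real j * \<bar>x - y\<bar>"
        using sep[OF xy(1,2,4)] by (intro mult_left_mono) auto
      ultimately show False using j
        by (smt (verit) abs_mult abs_of_nat right_diff_distrib)
    qed
    then show ?thesis by (simp add: card_image)
  qed
  obtain S where S: "S \<subseteq> U" "card S \<le> k"
    and un: "real (card {t\<in>I. c t ` F \<inter> S = {}}) \<le> real (card I) * exp (- (real (card F) * real k / real (card U)))"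
    using greedy_hitting_set[of U I "\<lambda>t. c t ` F" "card F" k] inU cardc finI by (auto simp: U_def)
  have "real (card I) * exp (- (real (card F) * real k / real (card U)))
      \<le> real (q * (R * q + 1)) * exp (- (real (card F) * real k / real ((R + 1) * q + 1)))"
    using cardI by (intro mult_mono) (auto simp: U_def simp del: of_nat_mult of_nat_add)
  then have card0: "card {t\<in>I. c t ` F \<inter> S = {}} = 0" using un small by linarith
  then have hit: "c t ` F \<inter> S \<noteq> {}" if "t \<in> I" for t
  proof -
    have "{t\<in>I. c t ` F \<inter> S = {}} = {}" using card0 finI by (subst (asm) card_0_eq) auto
    then show ?thesis using that by blast
  qed
  \<comment> \<open>Rounding \<open>a\<close> and \<open>b\<close> down to the grid moves a point by less than two cells.\<close>
  define G where "G = (\<Union>s\<in>S. {(real s - 1) / real q <..< (real s + 3) / real q})"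
  have finS: "finite S" using S(1) by (auto simp: U_def intro: finite_subset)
  have "emeasure lborel G \<le> (\<Sum>s\<in>S. emeasure lborel {(real s - 1) / real q <..< (real s + 3) / real q})"
    unfolding G_def by (rule emeasure_subadditive_finite) (use finS in auto)
  also have "\<dots> = (\<Sum>s\<in>S. ennreal (4 / real q))"
    using q0 by (intro sum.cong) (auto simp: divide_right_mono diff_divide_distrib[symmetric])
  also have "\<dots> = ennreal (real (card S) * (4 / real q))"
    by (simp add: ennreal_mult ennreal_of_nat_eq_real_of_nat del: times_divide_eq_right)
  also have "\<dots> \<le> ennreal (4 * real k / real q)"
    using S(2) by (intro ennreal_leI) (auto simp: divide_right_mono)
  finally have meas: "emeasure lborel G \<le> ennreal (4 * real k / real q)" .
  have "\<exists>x\<in>F. a + b * x \<in> G" if ab: "0 \<le> a" "a < 1" "1 / real R \<le> b" "b \<le> real R" for a b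
  proof -
    define i where "i = nat \<lfloor>a * q\<rfloor>"
    define j where "j = nat \<lfloor>b * q\<rfloor>"
    have b0: "0 < b" using ab(3) R by (smt (verit) divide_pos_pos of_nat_0_less_iff zero_less_one less_le_trans One_nat_def Suc_le_eq)
    have i0: "real i = of_int \<lfloor>a * q\<rfloor>" using ab q0 by (simp add: i_def)
    have i: "real i \<le> a * q" "a * q < real i + 1"
      using i0 by linarith+
    have j0: "real j = of_int \<lfloor>b * q\<rfloor>" using b0 q0 by (simp add: j_def)
    have j: "real j \<le> b * q" "b * q < real j + 1"
      using j0 by linarith+
    have "a * real q < 1 * real q" using ab q0 by (intro mult_strict_right_mono) auto
    then have "i < q" using i by linarith
    moreover have "j \<le> R * q"
    proof -
      have "b * real q \<le> real R * real q" using ab q0 by (intro mult_right_mono) auto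
      then have "real j \<le> real (R * q)" using j by simp
      then show ?thesis by linarith
    qed
    \<comment> \<open>The bound on \<open>q\<close> gives \<open>b * q \<ge> 2 / \<delta>\<close>.
      Rounding down to \<open>j\<close> loses less than 1, that is, less than
      \<open>\<delta> \<le> 1\<close> after multiplication by \<open>\<delta>\<close>.\<close>
    moreover have "1 \<le> real j * \<delta>"
    proof -
      have "2 / \<delta> \<le> real q / real R" using q R \<delta> by (simp add: field_simps)
      also have "\<dots> \<le> b * q" using ab(3) q0 mult_right_mono[of "1 / real R" b "real q"] by simp
      finally have "2 / \<delta> < real j + 1" using j by linarith
      then have "2 < real j * \<delta> + \<delta>" using \<delta> by (simp add: field_simps)
      then show ?thesis using \<delta> by linarith
    qed
    ultimately have "(i, j) \<in> I" by (simp add: I_def)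
    then obtain x where x: "x \<in> F" "c (i, j) x \<in> S" using hit by blast
    have x01: "0 \<le> x" "x \<le> 1" using x F by auto
    have cx: "real (c (i, j) x) \<le> i + j * x" "i + j * x < real (c (i, j) x) + 1"
    proof -
      have "0 \<le> real j * x" using x01 by simp
      then show "real (c (i, j) x) \<le> i + j * x" "i + j * x < real (c (i, j) x) + 1"
        unfolding c_def prod.case by linarith+
    qed
    have "(b * q - j) * x \<le> 1" "0 \<le> (b * q - j) * x"
      using j x01 by (auto intro!: mult_le_one)
    then have "real j * x \<le> b * q * x" "b * q * x \<le> real j * x + 1"
      by (auto simp: algebra_simps)
    \<comment> \<open>On the right, the rounding of \<open>a\<close>, that of \<open>b\<close> and
      the width of the cell contribute at most one unit each. The unit on the left lets the open
      interval contain the left end of the cell.\<close>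
    then have "real (c (i, j) x) - 1 < a * q + b * q * x" "a * q + b * q * x < real (c (i, j) x) + 3"
      using i cx by linarith+
    then have "a + b * x \<in> {(real (c (i, j) x) - 1) / real q <..< (real (c (i, j) x) + 3) / real q}"
      using q0 by (simp add: field_simps)
    then show ?thesis using x by (auto simp: G_def)
  qed
  moreover have "open G" by (auto simp: G_def)
  ultimately show ?thesis using meas by blast
qed

text \<open>With \<open>E = exp (\<sigma> * n)\<close> the separation is \<open>1 / E\<close>, the
  number of patterns is at most \<open>C * E ^ 2\<close>, and the greedy factor is at most
  \<open>1 / E ^ 4\<close>. The product \<open>C / E ^ 2\<close> is below 1 for large
  \<open>n\<close>, with thresholds depending on \<open>R\<close> and \<open>\<eta>\<close>
  alone.\<close>

lemma hitting_unit_translations: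
  fixes R :: nat and \<eta> :: real
  assumes R: "1 \<le> R" and \<eta>: "0 < \<eta>"
  obtains \<sigma> :: real and n0 :: nat where "0 < \<sigma>"
    and "\<forall>F :: real set. finite F \<longrightarrow> F \<subseteq> {0..1} \<longrightarrow> n0 \<le> card F \<longrightarrow>
      (\<forall>x\<in>F. \<forall>y\<in>F. x \<noteq> y \<longrightarrow> exp (- \<sigma> * real (card F)) \<le> \<bar>x - y\<bar>) \<longrightarrow>
      (\<exists>G. open G \<and> emeasure lborel G \<le> ennreal \<eta> \<and>
        (\<forall>a b. 0 \<le> a \<and> a < 1 \<and> 1 / real R \<le> b \<and> b \<le> real R \<longrightarrow> (\<exists>x\<in>F. a + b * x \<in> G)))"
proof -
  \<comment> \<open>About \<open>p * q\<close> cells of length \<open>4 / q\<close> have total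
    length \<open>\<eta> / 2\<close>; the other half pays for rounding \<open>k\<close> up.\<close>
  define p where "p = \<eta> / 8"
  \<comment> \<open>Chosen so that the greedy exponent, at least \<open>n * p / (R + 2)\<close>,
    equals \<open>4 * \<sigma> * n\<close> or more.\<close>
  define \<sigma> where "\<sigma> = p / (4 * (real R + 2))"
  define C where "C = 9 * real R ^ 2 * (real R + 1)"
  \<comment> \<open>This forces \<open>E > 8 / \<eta> + C\<close>: the term \<open>C\<close> makes
    \<open>C / E ^ 2 < 1\<close>, and \<open>8 / \<eta>\<close> bounds the rounding error of
    \<open>k\<close>.\<close>
  define n0 where "n0 = nat \<lceil>(8 / \<eta> + C) / \<sigma>\<rceil>"
  have p: "p > 0" using \<eta> by (simp add: p_def)
  have \<sigma>: "\<sigma> > 0" using p by (simp add: \<sigma>_def)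
  have C: "C > 0" using R by (simp add: C_def)
  have hit: "\<exists>G. open G \<and> emeasure lborel G \<le> ennreal \<eta> \<and>
        (\<forall>a b. 0 \<le> a \<and> a < 1 \<and> 1 / real R \<le> b \<and> b \<le> real R \<longrightarrow> (\<exists>x\<in>F. a + b * x \<in> G))"
    if F: "finite F" "F \<subseteq> {0..1}" "n0 \<le> card F"
      and sep: "\<forall>x\<in>F. \<forall>y\<in>F. x \<noteq> y \<longrightarrow> exp (- \<sigma> * real (card F)) \<le> \<bar>x - y\<bar>" for F :: "real set"
  proof -
    define n where "n = card F"
    define E where "E = exp (\<sigma> * real n)"
    define q where "q = nat \<lceil>2 * real R * E\<rceil>"
    define k where "k = nat \<lceil>p * real q\<rceil>"
    have "(8 / \<eta> + C) / \<sigma> \<le> real n" using F(3) unfolding n0_def n_def by linarith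
    then have "8 / \<eta> + C \<le> \<sigma> * real n" using \<sigma> by (simp add: field_simps)
    also have "\<dots> < E" unfolding E_def using exp_ge_add_one_self[of "\<sigma> * real n"] by linarith
    finally have E: "8 / \<eta> + C < E" .
    have E1: "E \<ge> 1" using \<sigma> by (simp add: E_def)
    have q: "2 * real R * E \<le> real q" unfolding q_def by linarith
    have RE: "1 \<le> real R * E" using R E1 mult_mono[of 1 "real R" 1 E] by simp
    have q': "real q \<le> 3 * real R * E" unfolding q_def using RE by linarith
    have q0: "real q > 0" using q RE by linarith
    have k: "p * real q \<le> real k" unfolding k_def by linarith
    have k': "real k \<le> p * real q + 1" unfolding k_def using p by (smt (verit) ceiling_correct of_nat_0_le_iff mult_nonneg_nonneg of_nat_nat zero_le_ceiling)
    have "real (q * (R * q + 1)) \<le> (real R + 1) * (real q)\<^sup>2"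
    proof -
      have "real q \<le> real q * real q" using q RE by (simp add: mult_le_cancel_left1)
      then show ?thesis by (simp add: algebra_simps power2_eq_square)
    qed
    also have "\<dots> \<le> (real R + 1) * (3 * real R * E)\<^sup>2"
      using q' by (intro mult_left_mono power_mono) auto
    also have "\<dots> = C * E ^ 2" by (simp add: C_def power_mult_distrib)
    finally have T: "real (q * (R * q + 1)) \<le> C * E ^ 2" .
    have "4 * \<sigma> * real n \<le> real n * real k / real ((R + 1) * q + 1)"
    proof -
      have M: "real ((R + 1) * q + 1) \<le> (real R + 2) * real q"
        using q RE by (simp add: algebra_simps)
      have "4 * \<sigma> * real n = real n * (p * real q) / ((real R + 2) * real q)"
      proof -
        have "4 * \<sigma> = p / (real R + 2)" unfolding \<sigma>_def by (simp del: distrib_left_numeral)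
        then show ?thesis using q0 by (simp add: mult.commute)
      qed
      also have "\<dots> \<le> real n * real k / real ((R + 1) * q + 1)"
        using k M by (intro frac_le mult_left_mono) (auto intro!: add_pos_nonneg)
      finally show ?thesis .
    qed
    then have "exp (- (real n * real k / real ((R + 1) * q + 1))) \<le> exp (- (4 * \<sigma> * real n))"
      by simp
    also have "\<dots> = 1 / E ^ 4"
      by (simp add: E_def exp_minus inverse_eq_divide exp_of_nat_mult[symmetric] mult.assoc)
    finally have "real (q * (R * q + 1)) * exp (- (real n * real k / real ((R + 1) * q + 1)))
        \<le> C * E ^ 2 * (1 / E ^ 4)"
      using T by (intro mult_mono) (auto simp: C_def)
    also have "\<dots> = C / E ^ 2" using E1 by (simp add: field_simps power_numeral_even power2_eq_square)
    also have "\<dots> < 1"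
    proof -
      have "C < E" using E \<eta> by (smt (verit) divide_pos_pos)
      also have "E \<le> E ^ 2" using E1 by (simp add: power2_eq_square mult_le_cancel_left1)
      finally show ?thesis using E1 by simp
    qed
    finally have small: "real (q * (R * q + 1)) * exp (- (real (card F) * real k / real ((R + 1) * q + 1))) < 1"
      by (simp add: n_def)
    have \<delta>: "exp (- \<sigma> * real (card F)) = 1 / E"
      by (simp add: E_def n_def exp_minus inverse_eq_divide)
    obtain G where G: "open G" "emeasure lborel G \<le> ennreal (4 * real k / real q)"
      "\<forall>a b. 0 \<le> a \<and> a < 1 \<and> 1 / real R \<le> b \<and> b \<le> real R \<longrightarrow> (\<exists>x\<in>F. a + b * x \<in> G)"
      using hitting_unit_translations_grid[OF F(1,2), of "1 / E" R q k] sep E1 R q small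
      unfolding \<delta> by auto
    have "4 * real k / real q \<le> \<eta>"
    proof -
      have "8 / \<eta> \<le> E" using E C by linarith
      also have "E \<le> real q"
      proof -
        have "1 * E \<le> real R * E" using R E1 by (intro mult_right_mono) auto
        then show ?thesis using q E1 by linarith
      qed
      finally have "8 \<le> \<eta> * real q" using \<eta> by (simp add: field_simps)
      then have "4 * real k \<le> \<eta> * real q" using k' by (simp add: p_def)
      then show ?thesis using q0 by (simp add: field_simps)
    qed
    then have "emeasure lborel G \<le> ennreal \<eta>" using G(2) ennreal_leI order_trans by blast
    then show ?thesis using G by blast
  qed
  show thesis by (rule that[OF \<sigma>]) (intro allI impI, rule hit)
qed

section \<open>Rescaling and bounded ranges of translations\<close>

lemma emeasure_lborel_affine_image:
  fixes A :: "real set"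
  assumes "A \<in> sets borel" "0 < c"
  shows "emeasure lborel ((\<lambda>x. t + c * x) ` A) = ennreal c * emeasure lborel A"
proof -
  have eq: "(\<lambda>x. t + c * x) ` A = (\<lambda>x. (x - t) / c) -` A"
    using assms(2) by (force simp: field_simps image_iff)
  have "(\<lambda>x. (x - t) / c) \<in> borel_measurable borel" by measurable
  then have "(\<lambda>x. t + c * x) ` A \<in> sets borel"
    using measurable_sets[OF _ assms(1), of "\<lambda>x. (x - t) / c" borel] eq by simp
  moreover have "(\<lambda>x. t + c * x) -` (\<lambda>x. t + c * x) ` A = A"
    using assms(2) by auto
  ultimately show ?thesis
    using assms(2) by (subst lborel_real_affine[of c t])
      (auto simp: emeasure_density nn_integral_distr emeasure_distr nn_integral_cmult cong: nn_integral_cong)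
qed

text \<open>After rescaling by \<open>1 / d\<close>, the translations fill an interval of length of
  order \<open>1 / d\<close>, which needs about that many integer translates of the unit solution.
  Scaling back multiplies each measure by \<open>d\<close>, so the cost stays bounded however small
  \<open>d\<close> is, and \<open>\<sigma>\<close> and \<open>n0\<close> can be fixed before
  \<open>F\<close>.\<close>

lemma hitting_bounded_similarities:
  fixes R :: nat and \<epsilon> B :: real
  assumes R: "1 \<le> R" and \<epsilon>: "0 < \<epsilon>" and B: "0 \<le> B"
  obtains \<sigma> :: real and n0 :: nat where "0 < \<sigma>"
    and "\<forall>(F :: real set) u d. finite F \<longrightarrow> F \<subseteq> {u..u + d} \<longrightarrow> n0 \<le> card F \<longrightarrow>
      0 < d \<longrightarrow> d \<le> B \<longrightarrow> \<bar>u\<bar> \<le> B \<longrightarrow>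
      (\<forall>x\<in>F. \<forall>y\<in>F. x \<noteq> y \<longrightarrow> d * exp (- \<sigma> * real (card F)) \<le> \<bar>x - y\<bar>) \<longrightarrow>
      (\<exists>G. open G \<and> emeasure lborel G \<le> ennreal \<epsilon> \<and>
        (\<forall>a b. \<bar>a\<bar> \<le> real R \<and> 1 / real R \<le> b \<and> b \<le> real R \<longrightarrow> (\<exists>x\<in>F. a + b * x \<in> G)))"
proof -
  define W where "W = real R + real R * B"
  \<comment> \<open>The \<open>2 * L + 1\<close> translates will cost at most
    \<open>(2 * W + 3 * B) * \<eta>\<close>, where \<open>W\<close> bounds
    \<open>\<bar>a + b * u\<bar>\<close>.\<close>
  define \<eta> where "\<eta> = \<epsilon> / (2 * W + 3 * B)"
  have W: "W > 0" using R B by (auto simp: W_def intro!: add_pos_nonneg)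
  have \<eta>: "\<eta> > 0" using \<epsilon> W B by (simp add: \<eta>_def)
  obtain \<sigma> n0 where \<sigma>: "\<sigma> > 0" and hit_unit: "\<forall>F :: real set. finite F \<longrightarrow> F \<subseteq> {0..1} \<longrightarrow> n0 \<le> card F \<longrightarrow>
      (\<forall>x\<in>F. \<forall>y\<in>F. x \<noteq> y \<longrightarrow> exp (- \<sigma> * real (card F)) \<le> \<bar>x - y\<bar>) \<longrightarrow>
      (\<exists>G. open G \<and> emeasure lborel G \<le> ennreal \<eta> \<and>
        (\<forall>a b. 0 \<le> a \<and> a < 1 \<and> 1 / real R \<le> b \<and> b \<le> real R \<longrightarrow> (\<exists>x\<in>F. a + b * x \<in> G)))"
    by (rule hitting_unit_translations[OF R \<eta>])
  have hit: "\<exists>G. open G \<and> emeasure lborel G \<le> ennreal \<epsilon> \<and>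
        (\<forall>a b. \<bar>a\<bar> \<le> real R \<and> 1 / real R \<le> b \<and> b \<le> real R \<longrightarrow> (\<exists>x\<in>F. a + b * x \<in> G))"
    if F: "finite F" "F \<subseteq> {u..u + d}" "n0 \<le> card F" and d: "0 < d" "d \<le> B" and u: "\<bar>u\<bar> \<le> B"
      and sep: "\<forall>x\<in>F. \<forall>y\<in>F. x \<noteq> y \<longrightarrow> d * exp (- \<sigma> * real (card F)) \<le> \<bar>x - y\<bar>"
    for F :: "real set" and u d
  proof -
    define F' where "F' = (\<lambda>x. (x - u) / d) ` F"
    have card: "card F' = card F"
      unfolding F'_def using d by (intro card_image) (auto simp: inj_on_def)
    have "finite F'" "F' \<subseteq> {0..1}" using F d by (auto simp: F'_def field_simps)
    moreover have "exp (- \<sigma> * real (card F')) \<le> \<bar>x - y\<bar>"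
      if xy: "x \<in> F'" "y \<in> F'" "x \<noteq> y" for x y
    proof -
      obtain x0 y0 where 0: "x0 \<in> F" "y0 \<in> F" "x = (x0 - u) / d" "y = (y0 - u) / d"
        using xy by (auto simp: F'_def)
      then have "d * exp (- \<sigma> * real (card F)) \<le> \<bar>x0 - y0\<bar>" using sep xy by auto
      also have "\<bar>x0 - y0\<bar> = d * \<bar>x - y\<bar>"
      proof -
        have "x0 - y0 = d * (x - y)" using d by (simp add: 0 field_simps)
        then show ?thesis using d by (simp add: abs_mult)
      qed
      finally show ?thesis using d card by simp
    qed
    ultimately obtain G0 where G0: "open G0" "emeasure lborel G0 \<le> ennreal \<eta>"
      "\<And>a b. 0 \<le> a \<and> a < 1 \<and> 1 / real R \<le> b \<and> b \<le> real R \<Longrightarrow> \<exists>x\<in>F'. a + b * x \<in> G0"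
      using hit_unit[rule_format, of F'] F(3) card by auto
    define L where "L = \<lceil>W / d\<rceil>"
    have L: "W / d \<le> L" "L < W / d + 1" by (auto simp: L_def) linarith+
    have "0 < W / d" using W d by simp
    then have L0: "0 \<le> L" using L by linarith
    define g where "g = (\<lambda>t::int. (\<lambda>x. d * of_int t + d * x) ` G0)"
    define G where "G = (\<Union>t\<in>{-L..L}. g t)"
    have og: "open (g t)" for t
      using open_affinity[OF G0(1), of d "d * of_int t"] d by (simp add: g_def)
    have mg: "emeasure lborel (g t) \<le> ennreal (d * \<eta>)" for t
    proof -
      have "emeasure lborel (g t) = ennreal d * emeasure lborel G0"
        unfolding g_def using d G0(1) by (intro emeasure_lborel_affine_image) auto
      also have "\<dots> \<le> ennreal d * ennreal \<eta>" by (intro mult_left_mono G0(2)) auto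
      finally show ?thesis using d \<eta> by (simp add: ennreal_mult)
    qed
    have "emeasure lborel G \<le> (\<Sum>t\<in>{-L..L}. emeasure lborel (g t))"
      unfolding G_def by (rule emeasure_subadditive_finite) (use og in auto)
    also have "\<dots> \<le> (\<Sum>t\<in>{-L..L}. ennreal (d * \<eta>))" by (intro sum_mono mg)
    also have "\<dots> = ennreal ((2 * of_int L + 1) * (d * \<eta>))"
      using L0 d \<eta> by (simp add: ennreal_mult ennreal_of_nat_eq_real_of_nat add_ac)
    also have "\<dots> \<le> ennreal \<epsilon>"
    proof (rule ennreal_leI)
      have "(2 * of_int L + 1) * d \<le> (2 * (W / d) + 3) * d"
        using L d by (intro mult_right_mono) auto
      also have "\<dots> = 2 * W + 3 * d" using d by (simp add: field_simps)
      also have "\<dots> \<le> 2 * W + 3 * B" using d by simp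
      finally have "(2 * of_int L + 1) * d * \<eta> \<le> (2 * W + 3 * B) * \<eta>"
        using \<eta> by (intro mult_right_mono) auto
      also have "\<dots> = \<epsilon>" using W B by (simp add: \<eta>_def)
      finally show "(2 * of_int L + 1) * (d * \<eta>) \<le> \<epsilon>" by (simp add: mult.assoc)
    qed
    finally have "emeasure lborel G \<le> ennreal \<epsilon>" .
    moreover have "open G" using og by (auto simp: G_def)
    moreover have "\<exists>x\<in>F. a + b * x \<in> G" if ab: "\<bar>a\<bar> \<le> real R" "1 / real R \<le> b" "b \<le> real R" for a b
    proof -
      \<comment> \<open>In rescaled coordinates the copy is \<open>a' + b * x\<close>. The integer
        part of \<open>a'\<close> selects the translate, and the fractional part is a translation
        covered by \<open>G0\<close>.\<close>
      define a' where "a' = (a + b * u) / d"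
      define t where "t = \<lfloor>a'\<rfloor>"
      have "0 \<le> b" using ab(2) R by (meson divide_nonneg_nonneg of_nat_0_le_iff order_trans zero_le_one)
      then have "\<bar>b * u\<bar> \<le> real R * B" using ab(3) u by (auto simp: abs_mult intro!: mult_mono)
      then have "\<bar>a + b * u\<bar> \<le> W" using ab(1) by (simp add: W_def)
      then have "\<bar>a'\<bar> \<le> W / d" using d by (simp add: a'_def divide_right_mono)
      then have "\<bar>a'\<bar> \<le> of_int L" using L by linarith
      then have t: "t \<in> {-L..L}" unfolding t_def by (auto simp: le_floor_iff floor_le_iff)
      have "0 \<le> a' - t \<and> a' - t < 1" unfolding t_def by linarith
      then obtain x where x: "x \<in> F'" "a' - t + b * x \<in> G0" using G0(3)[of "a' - t" b] ab by auto
      then obtain y where y: "y \<in> F" "x = (y - u) / d" by (auto simp: F'_def)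
      have "d * of_int t + d * (a' - t + b * x) = a + b * y"
      proof -
        have "d * a' = a + b * u" "d * x = y - u" using d by (auto simp: a'_def y)
        then show ?thesis by (simp add: distrib_left right_diff_distrib mult.left_commute[of d b])
      qed
      then have "a + b * y \<in> g t" unfolding g_def using x(2) by (metis imageI)
      then show ?thesis using y(1) t unfolding G_def by blast
    qed
    ultimately show ?thesis by blast
  qed
  show thesis by (rule that[OF \<sigma>]) (intro allI impI, rule hit)
qed

section \<open>Well-separated finite subsets avoiding a given finite set\<close>

lemma decreasing_gap_sum:
  fixes x :: "nat \<Rightarrow> real"
  assumes "\<And>l. l \<in> {1..n-1} \<Longrightarrow> g \<le> x l - x (l + 1)" and "0 \<le> g" and "1 \<le> i" "i \<le> j" "j \<le> n"
  shows "real (j - i) * g \<le> x i - x j"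
  using assms(4,5)
proof (induction j rule: dec_induct)
  case (step j)
  then have "g \<le> x j - x (j + 1)" using assms(1)[of j] assms(3) by auto
  then show ?case using step by (simp add: Suc_diff_le algebra_simps)
qed simp

text \<open>For large \<open>n\<close>, deleting \<open>K\<close> leaves at least half of the
  \<open>n\<close> points. Hence \<open>(1 - \<tau>) ^ n \<ge> exp (- 2 * \<tau> * n)\<close> is at
  least \<open>exp (- 4 * \<tau> * card F)\<close>. The length \<open>d\<close> remains that of the
  undeleted set, so the gap bound is inherited.\<close>

lemma separated_subsets:
  fixes X K :: "real set"
  assumes X: "\<And>x. x \<in> X \<Longrightarrow> \<bar>x\<bar> \<le> B"
    and H: "\<forall>\<sigma>0>0. \<exists>\<sigma>::real. 0 < \<sigma> \<and> \<sigma> < \<sigma>0 \<and>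
           (\<exists>(n::nat) (x :: nat \<Rightarrow> real).
              n \<ge> 3 \<and> x ` {1..n} \<subseteq> X \<and> (\<forall>i\<in>{1..n-1}. x i > x (i + 1)) \<and>
              Min ((\<lambda>i. (x i - x (i + 1)) / (x 1 - x n)) ` {1..n-1}) \<ge> (1 - \<sigma>) ^ n)"
    and K: "finite K" and \<sigma>: "0 < \<sigma>"
  obtains F u d where "finite F" "F \<subseteq> X - K" "F \<subseteq> {u..u + d}" "n0 \<le> card F"
    "0 < d" "d \<le> 2 * B" "\<bar>u\<bar> \<le> 2 * B"
    "\<forall>x\<in>F. \<forall>y\<in>F. x \<noteq> y \<longrightarrow> d * exp (- \<sigma> * real (card F)) \<le> \<bar>x - y\<bar>"
proof -
  define m where "m = n0 + 2 * card K + 1"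
  \<comment> \<open>The bound \<open>1/2\<close> serves the estimate
    \<open>1 - \<tau> \<ge> exp (- 2 * \<tau>)\<close>, \<open>\<sigma> / 4\<close> the separation
    after deletion, and \<open>1 / (2 * m)\<close> the proof that \<open>n \<ge> m\<close>.\<close>
  have "0 < Min {1/2, \<sigma> / 4, 1 / (2 * real m)}" using \<sigma> by (simp add: m_def)
  then obtain \<tau> n x where \<tau>: "0 < \<tau>" "\<tau> < Min {1/2, \<sigma> / 4, 1 / (2 * real m)}"
    and n: "n \<ge> 3" and xX: "x ` {1..n} \<subseteq> X" and dec: "\<forall>i\<in>{1..n-1}. x i > x (i + 1)"
    and mn: "Min ((\<lambda>i. (x i - x (i + 1)) / (x 1 - x n)) ` {1..n-1}) \<ge> (1 - \<tau>) ^ n"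
    using H by blast
  have \<tau>': "\<tau> < 1/2" "\<tau> < \<sigma> / 4" "\<tau> < 1 / (2 * real m)" using \<tau>(2) by auto
  define d where "d = x 1 - x n"
  define r where "r = (1 - \<tau>) ^ n"
  have r0: "0 < r" using \<tau>' by (simp add: r_def)
  have dec0: "0 \<le> x l - x (l + 1)" if "l \<in> {1..n-1}" for l using dec that by (simp add: less_imp_le)
  have d0: "0 < d"
  proof -
    have "0 \<le> x 2 - x n"
      using decreasing_gap_sum[where n = n and g = 0 and x = x and i = 2 and j = n] dec0 n by auto
    moreover have "x 1 > x 2" using bspec[OF dec, of 1] n by (simp add: numeral_2_eq_2)
    ultimately show ?thesis by (simp add: d_def)
  qed
  have gap: "r * d \<le> x l - x (l + 1)" if "l \<in> {1..n-1}" for l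
  proof -
    have "Min ((\<lambda>i. (x i - x (i + 1)) / (x 1 - x n)) ` {1..n-1}) \<le> (x l - x (l + 1)) / (x 1 - x n)"
      using that by (intro Min_le) auto
    then have "r \<le> (x l - x (l + 1)) / d" using mn by (simp add: r_def d_def)
    then show ?thesis using d0 by (simp add: pos_le_divide_eq)
  qed
  have rd: "0 \<le> r * d" using r0 d0 by simp
  have sepx: "r * d \<le> x i - x j" if "1 \<le> i" "i < j" "j \<le> n" for i j
  proof -
    have "1 * (r * d) \<le> real (j - i) * (r * d)" using that rd by (intro mult_right_mono) auto
    then show ?thesis using decreasing_gap_sum[where n = n and x = x, OF gap rd that(1) less_imp_le[OF that(2)] that(3)] by linarith
  qed
  have inj: "inj_on x {1..n}"
    using sepx r0 d0 by (intro linorder_inj_onI) (force simp: mult_le_0_iff)+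
  have "2 * (r * d) \<le> real (n - 1) * (r * d)" using n rd by (intro mult_right_mono) auto
  also have "\<dots> \<le> d" using decreasing_gap_sum[where n = n and x = x, OF gap rd, of 1 n] n by (simp add: d_def)
  finally have r_half: "r \<le> 1 / 2" using d0 by simp
  \<comment> \<open>Three points already force \<open>r \<le> 1/2\<close>, so a small \<open>\<tau>\<close> makes \<open>n\<close> large.\<close>
  have nm: "m \<le> n"
  proof (rule ccontr)
    assume "\<not> m \<le> n"
    then have "real n * \<tau> \<le> real m * \<tau>" using \<tau>(1) by (intro mult_right_mono) auto
    also have "\<dots> < 1 / 2" using \<tau>'(3) by (simp add: m_def field_simps)
    finally have "1 / 2 < 1 + real n * - \<tau>" by simp
    also have "\<dots> \<le> r"
      using Bernoulli_inequality[of "- \<tau>" n] \<tau>' by (simp add: r_def)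
    finally show False using r_half by simp
  qed
  have r_exp: "exp (- (2 * \<tau>) * real n) \<le> r"
  proof -
    have "\<tau> * \<tau> \<le> 1 / 2 * \<tau>" using \<tau>(1) \<tau>'(1) by (intro mult_right_mono) auto
    then have "- (2 * \<tau>) \<le> ln (1 - \<tau>)"
      using ln_one_minus_pos_lower_bound[of \<tau>] \<tau>(1) \<tau>'(1) unfolding power2_eq_square by linarith
    then have "exp (- (2 * \<tau>)) \<le> 1 - \<tau>" using \<tau>'(1) by (simp add: ln_ge_iff)
    then have "exp (- (2 * \<tau>)) ^ n \<le> r" unfolding r_def by (intro power_mono) auto
    then show ?thesis by (simp add: exp_of_nat_mult[symmetric] mult.commute)
  qed
  define F where "F = x ` {1..n} - K"
  have "n - card K \<le> card F"
    using diff_card_le_card_Diff[OF K, of "x ` {1..n}"] card_image[OF inj] by (simp add: F_def)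
  then have cF: "n0 \<le> card F" "n \<le> 2 * card F" using nm by (auto simp: m_def)
  have "d * exp (- \<sigma> * real (card F)) \<le> \<bar>y - z\<bar>" if yz: "y \<in> F" "z \<in> F" "y \<noteq> z" for y z
  proof -
    obtain i j where ij: "y = x i" "z = x j" "1 \<le> i" "i \<le> n" "1 \<le> j" "j \<le> n"
      using yz by (auto simp: F_def)
    have "2 * \<tau> * real n \<le> 2 * (\<sigma> / 4) * (2 * real (card F))"
      using \<tau>(1) \<tau>'(2) cF(2) by (intro mult_mono) auto
    then have "exp (- \<sigma> * real (card F)) \<le> exp (- (2 * \<tau>) * real n)" by simp
    then have "exp (- \<sigma> * real (card F)) \<le> r" using r_exp by (rule order_trans)
    then have "d * exp (- \<sigma> * real (card F)) \<le> d * r" using d0 by (intro mult_left_mono) auto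
    also have "\<dots> \<le> \<bar>y - z\<bar>"
      using sepx[of i j] sepx[of j i] ij yz(3) by (cases i j rule: linorder_cases) (auto simp: mult.commute)
    finally show ?thesis .
  qed
  moreover have "F \<subseteq> {x n..x n + d}"
  proof -
    have "x n \<le> x i \<and> x i \<le> x 1" if "1 \<le> i" "i \<le> n" for i
      using sepx[of i n] sepx[of 1 i] rd that by (cases "i = n"; cases "i = 1") auto
    then show ?thesis by (auto simp: F_def d_def)
  qed
  moreover have "\<bar>x 1\<bar> \<le> B" "\<bar>x n\<bar> \<le> B" using xX n by (auto intro!: X)
  \<comment> \<open>The bound on \<open>x n\<close> is weakened so that one constant bounds both
    \<open>d\<close> and \<open>u\<close>.\<close>
  then have "d \<le> 2 * B" "\<bar>x n\<bar> \<le> 2 * B" unfolding d_def by linarith+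
  moreover have "finite F" "F \<subseteq> X - K" using xX by (auto simp: F_def)
  ultimately show thesis using cF(1) d0 by (intro that[of F "x n" d]) auto
qed

section \<open>From bounded parameter ranges to infinitely many hits\<close>

lemma hitting_positive_similarities:
  fixes X :: "real set"
  assumes "bounded X"
    and H: "\<forall>\<sigma>0>0. \<exists>\<sigma>::real. 0 < \<sigma> \<and> \<sigma> < \<sigma>0 \<and>
           (\<exists>(n::nat) (x :: nat \<Rightarrow> real).
              n \<ge> 3 \<and> x ` {1..n} \<subseteq> X \<and> (\<forall>i\<in>{1..n-1}. x i > x (i + 1)) \<and>
              Min ((\<lambda>i. (x i - x (i + 1)) / (x 1 - x n)) ` {1..n-1}) \<ge> (1 - \<sigma>) ^ n)"
    and \<epsilon>: "0 < \<epsilon>"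
  shows "\<exists>G. open G \<and> emeasure lborel G \<le> ennreal \<epsilon> \<and> (\<forall>a b. 0 < b \<longrightarrow> infinite {x\<in>X. a + b * x \<in> G})"
proof -
  obtain B where B: "B > 0" "\<And>x. x \<in> X \<Longrightarrow> \<bar>x\<bar> \<le> B"
    using \<open>bounded X\<close> by (auto simp: bounded_pos)
  \<comment> \<open>\<open>Suc n\<close> provides a parameter bound of at least 1, and the measures
    allowed at the stages sum to \<open>\<epsilon>\<close>.\<close>
  define P where "P = (\<lambda>n (D::real set) G. open G \<and> emeasure lborel G \<le> ennreal (\<epsilon> * (1 / 2) ^ Suc n) \<and>
      (\<forall>a b. \<bar>a\<bar> \<le> real (Suc n) \<and> 1 / real (Suc n) \<le> b \<and> b \<le> real (Suc n) \<longrightarrow> (\<exists>x\<in>D. a + b * x \<in> G)))"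
  \<comment> \<open>\<open>K n\<close> collects the points excluded at stage \<open>n\<close>. Only
    these sets are carried through the recursion; intersecting the increment with \<open>X\<close>
    recovers the finite set used at that stage.\<close>
  have "\<exists>K. \<forall>n. finite (K n) \<and> (K n \<subseteq> K (Suc n) \<and> (\<exists>G. P n (X \<inter> (K (Suc n) - K n)) G))"
  proof (rule dependent_nat_choice)
    fix K :: "real set" and n assume K: "finite K"
    have "1 \<le> Suc n" "0 < \<epsilon> * (1 / 2) ^ Suc n" "0 \<le> 2 * B" using \<epsilon> B(1) by auto
    then obtain \<sigma> n0 where \<sigma>: "0 < \<sigma>" and hit: "\<forall>(F :: real set) u d.
      finite F \<longrightarrow> F \<subseteq> {u..u + d} \<longrightarrow> n0 \<le> card F \<longrightarrow> 0 < d \<longrightarrow> d \<le> 2 * B \<longrightarrow> \<bar>u\<bar> \<le> 2 * B \<longrightarrow>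
      (\<forall>x\<in>F. \<forall>y\<in>F. x \<noteq> y \<longrightarrow> d * exp (- \<sigma> * real (card F)) \<le> \<bar>x - y\<bar>) \<longrightarrow> (\<exists>G. P n F G)"
      unfolding P_def by (rule hitting_bounded_similarities)
    obtain F u d where F: "finite F" "F \<subseteq> X - K" and "F \<subseteq> {u..u + d}" "n0 \<le> card F"
      "0 < d" "d \<le> 2 * B" "\<bar>u\<bar> \<le> 2 * B"
      "\<forall>x\<in>F. \<forall>y\<in>F. x \<noteq> y \<longrightarrow> d * exp (- \<sigma> * real (card F)) \<le> \<bar>x - y\<bar>"
      by (rule separated_subsets[OF B(2) H K \<sigma>])
    then have "\<exists>G. P n F G" using hit[rule_format, of F u d] by simp
    moreover have "X \<inter> (K \<union> F - K) = F" using F(2) by auto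
    ultimately show "\<exists>K'. finite K' \<and> (K \<subseteq> K' \<and> (\<exists>G. P n (X \<inter> (K' - K)) G))"
      using F(1) K by (intro exI[of _ "K \<union> F"]) auto
  qed auto
  then obtain K where K: "\<And>n. K n \<subseteq> K (Suc n)" "\<And>n. \<exists>G. P n (X \<inter> (K (Suc n) - K n)) G"
    by blast
  from K(2) obtain g where g: "\<And>n. P n (X \<inter> (K (Suc n) - K n)) (g n)" by metis
  define G where "G = (\<Union>n. g n)"
  have "open G" using g by (auto simp: G_def P_def)
  moreover have "emeasure lborel G \<le> ennreal \<epsilon>"
  proof -
    have "emeasure lborel G \<le> (\<Sum>n. emeasure lborel (g n))"
      unfolding G_def by (rule emeasure_subadditive_countably) (use g in \<open>auto simp: P_def\<close>)
    also have "\<dots> \<le> (\<Sum>n. ennreal (\<epsilon> * (1 / 2) ^ Suc n))"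
      using g by (intro suminf_le) (auto simp: P_def)
    also have "\<dots> = ennreal \<epsilon>"
      using sums_mult[OF power_half_series, of \<epsilon>] \<epsilon> by (intro suminf_ennreal_eq) auto
    finally show ?thesis .
  qed
  moreover have "infinite {x\<in>X. a + b * x \<in> G}" if b: "0 < b" for a b
  proof -
    obtain N :: nat where "max \<bar>a\<bar> (max b (1 / b)) \<le> real N" using real_arch_simple by blast
    then have N: "\<bar>a\<bar> \<le> real N" "b \<le> real N" "1 / b \<le> real N" by auto
    \<comment> \<open>From stage \<open>N\<close> on, the pair \<open>(a, b)\<close> lies in the
      parameter range, so each later stage supplies a hit in its own increment.\<close>
    have "\<exists>y. y \<in> X \<inter> (K (Suc (n + N)) - K (n + N)) \<and> a + b * y \<in> g (n + N)" for n
    proof -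
      have "1 / b \<le> real (Suc (n + N))" using N(3) by simp
      then have "1 / real (Suc (n + N)) \<le> b" using b by (simp add: field_simps)
      moreover have "\<bar>a\<bar> \<le> real (Suc (n + N))" "b \<le> real (Suc (n + N))" using N by simp_all
      ultimately have "\<exists>y\<in>X \<inter> (K (Suc (n + N)) - K (n + N)). a + b * y \<in> g (n + N)"
        using g[of "n + N"] unfolding P_def by blast
      then show ?thesis by blast
    qed
    then obtain y where
      "\<forall>n. y n \<in> X \<inter> (K (Suc (n + N)) - K (n + N)) \<and> a + b * y n \<in> g (n + N)"
      using choice[of "\<lambda>n y. y \<in> X \<inter> (K (Suc (n + N)) - K (n + N)) \<and> a + b * y \<in> g (n + N)"] by blast
    then have y: "y n \<in> X" "y n \<in> K (Suc (n + N))" "y n \<notin> K (n + N)" "a + b * y n \<in> G" for n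
      unfolding G_def by blast+
    \<comment> \<open>The point \<open>y i\<close> has entered \<open>K\<close> by stage
      \<open>i + N + 1 \<le> j + N\<close>, whereas \<open>y j\<close> lies outside
      \<open>K (j + N)\<close>.\<close>
    have "y i \<noteq> y j" if "i < j" for i j
    proof -
      have "K (Suc (i + N)) \<subseteq> K (j + N)" by (rule lift_Suc_mono_le[where f = K]) (use that K(1) in simp_all)
      then show ?thesis using y(2)[of i] y(3)[of j] by auto
    qed
    then have "inj y" by (intro linorder_injI) auto
    then have "infinite (range y)" by (rule range_inj_infinite)
    moreover have "range y \<subseteq> {x\<in>X. a + b * x \<in> G}" using y by auto
    ultimately show ?thesis by (rule infinite_super[rotated])
  qed
  ultimately show ?thesis by blast
qed

section \<open>Reflections and arbitrary similar copies\<close>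

text \<open>A negative ratio becomes positive under reflection in 0, so the union of
  \<open>G\<close> and its mirror image works for both signs. Starting from
  \<open>\<epsilon> / 3\<close> makes the final bound strict.\<close>

lemma hitting_similar_copies:
  fixes X :: "real set"
  assumes "bounded X"
    and H: "\<forall>\<sigma>0>0. \<exists>\<sigma>::real. 0 < \<sigma> \<and> \<sigma> < \<sigma>0 \<and>
           (\<exists>(n::nat) (x :: nat \<Rightarrow> real).
              n \<ge> 3 \<and> x ` {1..n} \<subseteq> X \<and> (\<forall>i\<in>{1..n-1}. x i > x (i + 1)) \<and>
              Min ((\<lambda>i. (x i - x (i + 1)) / (x 1 - x n)) ` {1..n-1}) \<ge> (1 - \<sigma>) ^ n)"
    and \<epsilon>: "0 < \<epsilon>"
  shows "\<exists>G. open G \<and> emeasure lebesgue G < ennreal \<epsilon> \<and> (\<forall>Y. similar_copy Y X \<longrightarrow> infinite (Y \<inter> G))"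
proof -
  obtain G where G: "open G" "emeasure lborel G \<le> ennreal (\<epsilon> / 3)"
    and inf: "\<And>a b. 0 < b \<Longrightarrow> infinite {x\<in>X. a + b * x \<in> G}"
    using hitting_positive_similarities[OF assms(1) H, of "\<epsilon> / 3"] \<epsilon> by auto
  define G' where "G' = G \<union> uminus -` G"
  have oG: "open (uminus -` G)" by (intro open_vimage G(1) continuous_intros)
  have "emeasure lborel (uminus -` G) = emeasure (distr lborel borel uminus) G"
    using G(1) by (simp add: emeasure_distr)
  then have m: "emeasure lborel (uminus -` G) = emeasure lborel G"
    by (simp add: lborel_distr_uminus)
  have "emeasure lebesgue G' = emeasure lborel G'" using G(1) oG by (simp add: G'_def)
  also have "\<dots> \<le> emeasure lborel G + emeasure lborel (uminus -` G)"
    unfolding G'_def by (rule emeasure_subadditive) (use G(1) oG in auto)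
  also have "\<dots> \<le> ennreal (\<epsilon> / 3) + ennreal (\<epsilon> / 3)" using G(2) m by (simp add: add_mono)
  also have "\<dots> < ennreal \<epsilon>" using \<epsilon> by (simp flip: ennreal_plus add: ennreal_less_iff)
  finally have "emeasure lebesgue G' < ennreal \<epsilon>" .
  moreover have "open G'" using G(1) oG by (auto simp: G'_def)
  moreover have "infinite (Y \<inter> G')" if Y_copy: "similar_copy Y X" for Y
  proof -
    obtain a b where b: "b \<noteq> 0" and Y: "Y = (\<lambda>x. a + b * x) ` X"
      using Y_copy unfolding similar_copy_def by (elim exE conjE) (rule that)
    have "infinite {x\<in>X. a + b * x \<in> G'}"
    proof (cases "0 < b")
      case True
      have "{x\<in>X. a + b * x \<in> G} \<subseteq> {x\<in>X. a + b * x \<in> G'}" by (auto simp: G'_def)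
      then show ?thesis by (rule infinite_super) (rule inf[OF True])
    next
      case False
      then have "0 < - b" using b by simp
      then have "infinite {x\<in>X. - a + - b * x \<in> G}" by (rule inf)
      moreover have "{x\<in>X. - a + - b * x \<in> G} \<subseteq> {x\<in>X. a + b * x \<in> G'}" by (auto simp: G'_def)
      ultimately show ?thesis by (rule infinite_super[rotated])
    qed
    moreover have "inj_on (\<lambda>x. a + b * x) {x\<in>X. a + b * x \<in> G'}" using b by (auto simp: inj_on_def)
    ultimately have "infinite ((\<lambda>x. a + b * x) ` {x\<in>X. a + b * x \<in> G'})" by (simp add: finite_image_iff)
    moreover have "(\<lambda>x. a + b * x) ` {x\<in>X. a + b * x \<in> G'} \<subseteq> Y \<inter> G'" by (auto simp: Y)
    ultimately show ?thesis by (rule infinite_super[rotated])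
  qed
  ultimately show ?thesis by blast
qed

theorem theorem15:
  fixes X :: "real set"
  assumes "bounded X" and "infinite X"
    and "\<forall>\<sigma>0>0. \<exists>\<sigma>::real. 0 < \<sigma> \<and> \<sigma> < \<sigma>0 \<and>
           (\<exists>(n::nat) (x :: nat \<Rightarrow> real).
              n \<ge> 3 \<and> x ` {1..n} \<subseteq> X \<and> (\<forall>i\<in>{1..n-1}. x i > x (i + 1)) \<and>
              Min ((\<lambda>i. (x i - x (i + 1)) / (x 1 - x n)) ` {1..n-1}) \<ge> (1 - \<sigma>) ^ n)"
  shows "nonuniversal_cofinite_measure X \<and>
     (\<forall>\<epsilon>::real. \<epsilon> > 0 \<longrightarrow> (\<exists>G :: real set. open G \<and> emeasure lebesgue G < ennreal \<epsilon> \<and>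
        (\<forall>Y. similar_copy Y X \<longrightarrow> infinite (Y \<inter> G)) \<and>
        (\<forall>K. finite K \<longrightarrow> \<not> (\<exists>Y. similar_copy Y (X - K) \<and> Y \<subseteq> UNIV - G))))"
proof (intro conjI allI impI)
  obtain G where G: "open G" "emeasure lebesgue G < ennreal 1" "\<forall>Y. similar_copy Y X \<longrightarrow> infinite (Y \<inter> G)"
    using hitting_similar_copies[OF assms(1,3), of 1] by auto
  have "emeasure lebesgue (UNIV - (UNIV - G)) < \<infinity>"
    using G(2) by (simp add: Diff_Diff_Int order_less_trans[OF _ ennreal_one_less_top])
  moreover have "UNIV - G \<in> sets lebesgue" using G(1) by (intro sets.Diff) auto
  moreover have "\<not> Y \<subseteq> UNIV - G" if "similar_copy Y X" for Y
  proof
    assume "Y \<subseteq> UNIV - G"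
    then have "Y \<inter> G = {}" by auto
    then show False using G(3) that by (metis finite.emptyI)
  qed
  ultimately show "nonuniversal_cofinite_measure X"
    unfolding nonuniversal_cofinite_measure_def by blast
next
  fix \<epsilon> :: real assume "\<epsilon> > 0"
  then obtain G where G: "open G" "emeasure lebesgue G < ennreal \<epsilon>"
    "\<forall>Y. similar_copy Y X \<longrightarrow> infinite (Y \<inter> G)"
    using hitting_similar_copies[OF assms(1,3)] by blast
  have "\<not> Y \<subseteq> UNIV - G" if K: "finite K" and Y: "similar_copy Y (X - K)" for K Y
  proof
    assume sub: "Y \<subseteq> UNIV - G"
    obtain a b where b: "b \<noteq> 0" and Y: "Y = (\<lambda>x. a + b * x) ` (X - K)"
      using Y unfolding similar_copy_def by (elim exE conjE) (rule that)
    \<comment> \<open>The same \<open>a\<close> and \<open>b\<close> give a copy of all of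
      \<open>X\<close>. If the copy of \<open>X - K\<close> misses \<open>G\<close>, that larger
      copy meets \<open>G\<close> only in images of points of \<open>K\<close>, which are finitely
      many.\<close>
    have "(\<lambda>x. a + b * x) ` X \<inter> G \<subseteq> (\<lambda>x. a + b * x) ` K" using sub Y by auto
    moreover have "infinite ((\<lambda>x. a + b * x) ` X \<inter> G)" using G(3) b by (auto simp: similar_copy_def)
    ultimately show False using K finite_subset by blast
  qed
  then show "\<exists>G. open G \<and> emeasure lebesgue G < ennreal \<epsilon> \<and>
        (\<forall>Y. similar_copy Y X \<longrightarrow> infinite (Y \<inter> G)) \<and>
        (\<forall>K. finite K \<longrightarrow> \<not> (\<exists>Y. similar_copy Y (X - K) \<and> Y \<subseteq> UNIV - G))"
    using G by blast
qed

end
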